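(* Let $K$ be a field, let $S=K[X_1,\ldots,X_n]$, and let $I\subset S$ be a nonzero proper monomial ideal with a linear resolution. Then the following conditions are equivalent: (i) the Taylor resolution of $I$ is minimal; (ii) $I = u\cdot (X_{i_1},\ldots,X_{i_k})$ for some $k\ge 1$, some indices $1\leq i_1<\cdots<i_k\leq n$ and some monomial $u\in S$. In this case, $I$ is an ideal with linear quotients.
   Context: A monomial ideal $I$ has a linear resolution if all its minimal generators have the same degree $d$ and its minimal graded free resolution is linear, i.e. the $q$-th free module in the minimal graded free resolution of $I$ is generated in degree $d+q$ for all $q\ge 0$. For a monomial ideal $I\subset S$, let $G(I)=\{u_1,\ldots,u_r\}$ be its minimal set of monomial generators. The Taylor resolution $(T_\bullet(I),d_\bullet)$ of $I$: let $L$ be the free $S$-module with basis $e_1,\ldots,e_r$; set $T_q(I)=\bigwedge^{q+1}L$ for $q=0,\ldots,r-1$; for $q=1,\ldots,r-1$ the map $d_q:T_q(I)\to T_{q-1}(I)$ is $$d_q(e_{i_0}\wedge\cdots\wedge e_{i_q})=\sum_{s=0}^{q}(-1)^s\frac{\mathrm{lcm}(u_{i_0},\ldots,u_{i_q})}{\mathrm{lcm}(u_{i_0},\ldots,\check{u}_{i_s},\ldots,u_{i_q})}\, e_{i_0}\wedge\cdots\check{e}_{i_s}\cdots\wedge e_{i_q},$$ where $\check{\ }$ denotes omission, and the augmentation $\epsilon:T_0(I)\to I$ is $\epsilon(e_i)=u_i$. This is a free resolution of $I$; it is minimal if it is a minimal (multigraded) free resolution, i.e. $d_q(T_q(I))\subseteq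 (X_1,\ldots,X_n)T_{q-1}(I)$ for all $q\ge 1$. A monomial ideal $I$ is an ideal with linear quotients if, for some order $u_1,\ldots,u_r$ of the elements of $G(I)$, the colon ideal $(u_1,\ldots,u_{j-1}):u_j$ is generated by a subset of $\{X_1,\ldots,X_n\}$ for each $j=1,\ldots,r$ (the empty subset, generating the zero ideal, for $j=1$). *)

theory Defs
  imports Complex_Main "HOL-Library.Poly_Mapping" "HOL-Library.FuncSet"
begin

section \<open>Polynomials and ideals\<close>

text \<open>A monomial is its exponent vector, the product of monomials is the sum of exponent vectors,
  and the finite type \<^typ>\<open>'n\<close> indexes the variables.\<close>

type_synonym 'n monom = "'n \<Rightarrow>\<^sub>0 nat"
type_synonym ('n, 'k) mpoly = "('n \<Rightarrow>\<^sub>0 nat) \<Rightarrow>\<^sub>0 'k"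

definition mon :: "'n monom \<Rightarrow> ('n, 'k::comm_ring_1) mpoly"
  where "mon m = Poly_Mapping.single m 1"

definition Var :: "'n \<Rightarrow> ('n, 'k::comm_ring_1) mpoly"
  where "Var x = mon (Poly_Mapping.single x 1)"

definition mdeg :: "'n::finite monom \<Rightarrow> nat"
  where "mdeg m = (\<Sum>x\<in>UNIV. Poly_Mapping.lookup m x)"

definition lcm_monom :: "'n::finite monom set \<Rightarrow> 'n monom"
  where "lcm_monom M = Abs_poly_mapping (\<lambda>x. Max ((\<lambda>m. Poly_Mapping.lookup m x) ` M))"

lemma lookup_lcm_monom:
  "Poly_Mapping.lookup (lcm_monom M) x = Max ((\<lambda>m. Poly_Mapping.lookup m x) ` M)"
  by (simp add: lcm_monom_def lookup_Abs_poly_mapping)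

text \<open>Ideals are the submodules of the ring regarded as a module over itself.\<close>

lemma module_times: "module ((*) :: 'r::comm_ring_1 \<Rightarrow> 'r \<Rightarrow> 'r)"
  by unfold_locales (auto simp: algebra_simps)

abbreviation ideal_gen :: "'r::comm_ring_1 set \<Rightarrow> 'r set"
  where "ideal_gen \<equiv> module.span (*)"

definition colon_ideal :: "'r::comm_ring_1 set \<Rightarrow> 'r \<Rightarrow> 'r set"
  where "colon_ideal I f = {g. g * f \<in> I}"

definition monomial_ideal :: "('n::finite, 'k::field) mpoly set \<Rightarrow> bool"
  where "monomial_ideal I \<longleftrightarrow> (\<exists>M. I = ideal_gen (mon ` M))"

definition minimal_monomial_generators :: "('n::finite, 'k::field) mpoly set \<Rightarrow> 'n monom set \<Rightarrow> bool"
  where "minimal_monomial_generators I M \<longleftrightarrow>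
    ideal_gen (mon ` M) = I \<and> (\<forall>M'. M' \<subset> M \<longrightarrow> ideal_gen (mon ` M') \<noteq> I)"

text \<open>Existence and uniqueness of this set for a monomial ideal are shown below.\<close>

definition min_gens :: "('n::finite, 'k::field) mpoly set \<Rightarrow> 'n monom set"
  where "min_gens I = (THE M. minimal_monomial_generators I M)"

lemma mem_ideal_mon:
  fixes f :: "('n::finite, 'k::field) mpoly"
  shows "f \<in> ideal_gen (mon ` M) \<longleftrightarrow>
    (\<forall>m\<in>Poly_Mapping.keys f. \<exists>m'\<in>M. \<exists>k. m = m' + k)"
    (is "_ \<longleftrightarrow> ?P f")
proof
  interpret module "(*) :: ('n, 'k) mpoly \<Rightarrow> _" by (rule module_times)
  have "subspace (Collect ?P)"
    unfolding subspace_def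
  proof (intro conjI ballI allI)
    show "0 \<in> Collect ?P" by simp
    show "f + g \<in> Collect ?P" if "f \<in> Collect ?P" "g \<in> Collect ?P" for f g
      using that keys_add[of f g] by blast
    show "c * f \<in> Collect ?P" if "f \<in> Collect ?P" for c f
    proof (clarsimp)
      fix m assume "m \<in> Poly_Mapping.keys (c * f)"
      then obtain a b where "m = a + b" "b \<in> Poly_Mapping.keys f"
        using keys_mult[of c f] by blast
      moreover from this that obtain m' k where "m' \<in> M" "b = m' + k" by blast
      ultimately have "m' \<in> M" "m = m' + (k + a)" by (simp_all add: algebra_simps)
      then show "\<exists>m'\<in>M. \<exists>k. m = m' + k" by blast
    qed
  qed
  moreover have "\<exists>m'\<in>M. \<exists>k. m = m' + k" if "m \<in> M" for m
    using that by (intro bexI[of _ m] exI[of _ 0]) simp_all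
  then have "mon ` M \<subseteq> Collect ?P"
    by (auto simp: mon_def)
  ultimately show "?P f" if "f \<in> ideal_gen (mon ` M)"
    using span_minimal that by blast
  show "f \<in> ideal_gen (mon ` M)" if P: "?P f"
  proof -
    have "Poly_Mapping.single m (Poly_Mapping.lookup f m) \<in> ideal_gen (mon ` M)"
      if m: "m \<in> Poly_Mapping.keys f" for m
    proof -
      obtain m' k where "m' \<in> M" "m = m' + k" using P m by blast
      then have "Poly_Mapping.single m (Poly_Mapping.lookup f m) =
          Poly_Mapping.single k (Poly_Mapping.lookup f m) * mon m'"
        by (simp add: mon_def mult_single add.commute)
      then show ?thesis
        using \<open>m' \<in> M\<close> by (simp add: span_base span_scale)
    qed
    moreover have "f = (\<Sum>m\<in>Poly_Mapping.keys f. Poly_Mapping.single m (Poly_Mapping.lookup f m))"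
      by (rule poly_mapping_eqI)
        (auto simp: lookup_sum lookup_single when_def in_keys_iff)
    ultimately show ?thesis by (subst \<open>f = _\<close>) (rule span_sum)
  qed
qed

lemma minimal_monomial_generators_unique:
  fixes I :: "('n::finite, 'k::field) mpoly set"
  assumes "monomial_ideal I"
  shows "\<exists>!M. minimal_monomial_generators I M"
proof -
  define N where "N = {m. mon m \<in> I \<and> (\<forall>m' k. mon m' \<in> I \<longrightarrow> m = m' + k \<longrightarrow> k = 0)}"
  have mon_mem: "mon m \<in> I \<longleftrightarrow> (\<exists>m'\<in>M. \<exists>k. m = m' + k)" if "ideal_gen (mon ` M) = I" for M m
    unfolding that[symmetric] mem_ideal_mon by (simp add: mon_def)
  have N_sub: "N \<subseteq> M" if M: "ideal_gen (mon ` M) = I" for M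
  proof
    fix m assume m: "m \<in> N"
    then obtain m' k where m': "m' \<in> M" "m = m' + k"
      using mon_mem[OF M] by (auto simp: N_def)
    moreover have "mon m' \<in> I"
      using mon_mem[OF M, of m'] m'(1) add.right_neutral[of m', symmetric] by blast
    ultimately show "m \<in> M" using m by (auto simp: N_def)
  qed
  have below: "\<exists>m'\<in>N. \<exists>k. m = m' + k" if "mon m \<in> I" for m
    using that
  proof (induction "mdeg m" arbitrary: m rule: less_induct)
    case less
    show ?case
    proof (cases "m \<in> N")
      case True
      then show ?thesis using add.right_neutral[of m, symmetric] by blast
    next
      case False
      with less.prems obtain m' k where mk: "mon m' \<in> I" "m = m' + k" "k \<noteq> 0"
        by (auto simp: N_def)
      from \<open>k \<noteq> 0\<close> obtain x where "Poly_Mapping.lookup k x \<noteq> 0"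
        by (metis lookup_zero poly_mapping_eqI)
      moreover have "Poly_Mapping.lookup k x \<le> mdeg k"
        unfolding mdeg_def by (rule member_le_sum) auto
      ultimately have "mdeg k \<noteq> 0" by simp
      moreover have "mdeg m = mdeg m' + mdeg k"
        by (simp add: mk(2) mdeg_def lookup_add sum.distrib)
      ultimately have "mdeg m' < mdeg m" by linarith
      with less.hyps mk(1) obtain m'' k' where "m'' \<in> N" "m' = m'' + k'" by blast
      then show ?thesis using mk(2) add.assoc[of m'' k' k] by blast
    qed
  qed
  obtain M where M: "ideal_gen (mon ` M) = I"
    using assms by (auto simp: monomial_ideal_def)
  have "f \<in> ideal_gen (mon ` N) \<longleftrightarrow> f \<in> I" for f
  proof -
    have "(\<exists>m'\<in>M. \<exists>k. m = m' + k) \<longleftrightarrow> (\<exists>m'\<in>N. \<exists>k. m = m' + k)" for m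
      using below mon_mem[OF M] N_sub[OF M] by blast
    then show ?thesis unfolding M[symmetric] mem_ideal_mon by simp
  qed
  then have N: "ideal_gen (mon ` N) = I" by blast
  show ?thesis
  proof
    show "minimal_monomial_generators I N"
      unfolding minimal_monomial_generators_def
    proof (intro conjI allI impI notI)
      fix M' assume "M' \<subset> N" "ideal_gen (mon ` M') = I"
      then show False using N_sub[of M'] by simp
    qed (rule N)
  next
    fix M' assume M': "minimal_monomial_generators I M'"
    then have "N \<subseteq> M'"
      by (intro N_sub) (simp add: minimal_monomial_generators_def)
    moreover have "\<not> N \<subset> M'"
      using M' N unfolding minimal_monomial_generators_def by metis
    ultimately show "M' = N" by blast
  qed
qed

lemma minimal_monomial_generators_min_gens:
  "monomial_ideal I \<Longrightarrow> minimal_monomial_generators I (min_gens I)"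
  unfolding min_gens_def by (rule theI'[OF minimal_monomial_generators_unique])

definition linear_quotients :: "('n::finite, 'k::field) mpoly set \<Rightarrow> bool"
  where "linear_quotients I \<longleftrightarrow>
    (\<exists>us. distinct us \<and> set us = min_gens I \<and>
      (\<forall>j < length us. \<exists>A.
        colon_ideal (ideal_gen (mon ` set (take j us))) (mon (us ! j) :: ('n, 'k) mpoly) =
          ideal_gen (Var ` A)))"


section \<open>Free modules\<close>

text \<open>The free module with basis \<open>B\<close> over a ring consists of the finitely supported functions
  with support in \<open>B\<close>; the basis element belonging to \<open>b\<close> is \<open>Poly_Mapping.single b 1\<close>.\<close>

definition fscale :: "'r::comm_ring_1 \<Rightarrow> ('b \<Rightarrow>\<^sub>0 'r) \<Rightarrow> ('b \<Rightarrow>\<^sub>0 'r)"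
  where "fscale a = Poly_Mapping.map ((*) a)"

definition free_mod :: "'b set \<Rightarrow> ('b \<Rightarrow>\<^sub>0 'r::comm_ring_1) set"
  where "free_mod B = {v. Poly_Mapping.keys v \<subseteq> B}"

definition linear_extension :: "('b \<Rightarrow> 'c \<Rightarrow>\<^sub>0 'r::comm_ring_1) \<Rightarrow> ('b \<Rightarrow>\<^sub>0 'r) \<Rightarrow> ('c \<Rightarrow>\<^sub>0 'r)"
  where "linear_extension f v =
    (\<Sum>b\<in>Poly_Mapping.keys v. fscale (Poly_Mapping.lookup v b) (f b))"

definition ideal_times :: "'r::comm_ring_1 set \<Rightarrow> ('b \<Rightarrow>\<^sub>0 'r) set \<Rightarrow> ('b \<Rightarrow>\<^sub>0 'r) set"
  where "ideal_times J F = module.span fscale {fscale a v | a v. a \<in> J \<and> v \<in> F}"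

lemma lookup_fscale [simp]:
  "Poly_Mapping.lookup (fscale a v) b = a * Poly_Mapping.lookup v b"
  by (simp add: fscale_def Poly_Mapping.map.rep_eq when_def)

lemma module_fscale: "module (fscale :: 'r::comm_ring_1 \<Rightarrow> ('b \<Rightarrow>\<^sub>0 'r) \<Rightarrow> ('b \<Rightarrow>\<^sub>0 'r))"
  by unfold_locales (auto intro!: poly_mapping_eqI simp: lookup_add algebra_simps)


section \<open>Graded free resolutions\<close>

text \<open>The grading is the one in which the basis element \<open>b\<close> has degree \<open>dg b\<close>.\<close>

definition homogeneous ::
    "('b \<Rightarrow> int) \<Rightarrow> int \<Rightarrow> ('b \<Rightarrow>\<^sub>0 ('n::finite, 'k::field) mpoly) \<Rightarrow> bool"
  where "homogeneous dg a v \<longleftrightarrow>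
    (\<forall>b\<in>Poly_Mapping.keys v. \<forall>m\<in>Poly_Mapping.keys (Poly_Mapping.lookup v b).
      int (mdeg m) + dg b = a)"

definition generated_in_degree ::
    "('b \<Rightarrow>\<^sub>0 ('n::finite, 'k::field) mpoly) set \<Rightarrow> ('b \<Rightarrow> int) \<Rightarrow> int \<Rightarrow> bool"
  where "generated_in_degree F dg a \<longleftrightarrow> module.span fscale {v \<in> F. homogeneous dg a v} = F"

text \<open>The \<open>q\<close>-th module has basis \<open>B q\<close>, whose elements have the degrees \<open>dg q\<close>; the differential
  \<open>d (Suc q)\<close> maps the module number \<open>Suc q\<close> to the module number \<open>q\<close> (\<open>d 0\<close> plays no role), and
  \<open>\<epsilon>\<close> is the augmentation onto \<open>I\<close>. A linear map out of the free module with basis \<open>B q\<close> is given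
  as a linear map out of the free module on the whole index type, of which only the restriction
  matters.\<close>

definition graded_free_resolution ::
    "('n::finite, 'k::field) mpoly set \<Rightarrow> (nat \<Rightarrow> 'b set) \<Rightarrow> (nat \<Rightarrow> 'b \<Rightarrow> int) \<Rightarrow>
     (nat \<Rightarrow> ('b \<Rightarrow>\<^sub>0 ('n, 'k) mpoly) \<Rightarrow> ('b \<Rightarrow>\<^sub>0 ('n, 'k) mpoly)) \<Rightarrow>
     (('b \<Rightarrow>\<^sub>0 ('n, 'k) mpoly) \<Rightarrow> ('n, 'k) mpoly) \<Rightarrow> bool"
  where "graded_free_resolution I B dg d \<epsilon> \<longleftrightarrow>
    (\<forall>q. finite (B q)) \<and>
    module_hom fscale (*) \<epsilon> \<and>
    (\<forall>q. module_hom fscale fscale (d (Suc q))) \<and>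
    (\<forall>b\<in>B 0. \<forall>m\<in>Poly_Mapping.keys (\<epsilon> (Poly_Mapping.single b 1)). int (mdeg m) = dg 0 b) \<and>
    (\<forall>q. \<forall>b\<in>B (Suc q). homogeneous (dg q) (dg (Suc q) b) (d (Suc q) (Poly_Mapping.single b 1))) \<and>
    \<epsilon> ` free_mod (B 0) = I \<and>
    d 1 ` free_mod (B 1) = {v \<in> free_mod (B 0). \<epsilon> v = 0} \<and>
    (\<forall>q. d (Suc (Suc q)) ` free_mod (B (Suc (Suc q))) =
         {v \<in> free_mod (B (Suc q)). d (Suc q) v = 0})"

definition minimal_differentials ::
    "(nat \<Rightarrow> 'b set) \<Rightarrow>
     (nat \<Rightarrow> ('b \<Rightarrow>\<^sub>0 ('n::finite, 'k::field) mpoly) \<Rightarrow> ('b \<Rightarrow>\<^sub>0 ('n, 'k) mpoly)) \<Rightarrow> bool"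
  where "minimal_differentials B d \<longleftrightarrow>
    (\<forall>q. d (Suc q) ` free_mod (B (Suc q)) \<subseteq>
         ideal_times (ideal_gen (range Var)) (free_mod (B q)))"

text \<open>The minimal graded free resolution of \<open>I\<close> is unique up to isomorphism, and its modules have
  finite rank, so that bases inside the natural numbers suffice.\<close>

definition linear_resolution :: "('n::finite, 'k::field) mpoly set \<Rightarrow> bool"
  where "linear_resolution I \<longleftrightarrow>
    (\<exists>e::nat. (\<forall>u\<in>min_gens I. mdeg u = e) \<and>
      (\<exists>(B :: nat \<Rightarrow> nat set) dg d \<epsilon>.
        graded_free_resolution I B dg d \<epsilon> \<and> minimal_differentials B d \<and>
        (\<forall>q. generated_in_degree (free_mod (B q) :: (nat \<Rightarrow>\<^sub>0 ('n, 'k) mpoly) set)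
               (dg q) (int e + int q))))"

lemma linear_resolution_enumeration:
  fixes I :: "('n::finite, 'k::field) mpoly set"
  assumes "linear_resolution I"
  shows "\<exists>us. distinct us \<and> set us = min_gens I"
proof -
  obtain e where e: "\<forall>u\<in>min_gens I. mdeg u = e"
    using assms by (auto simp: linear_resolution_def)
  have "Poly_Mapping.lookup u x \<le> mdeg u" for u :: "'n monom" and x
    unfolding mdeg_def by (rule member_le_sum) auto
  then have "Poly_Mapping.lookup ` min_gens I \<subseteq> (UNIV :: 'n set) \<rightarrow>\<^sub>E {..e}"
    using e by fastforce
  then have "finite (Poly_Mapping.lookup ` min_gens I)"
    by (rule finite_subset) (auto intro: finite_PiE)
  then have "finite (min_gens I)"
    by (rule finite_imageD) (simp add: inj_on_def)
  then show ?thesis using finite_distinct_list by blast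
qed


section \<open>The Taylor resolution\<close>

text \<open>For a list \<open>us\<close> of \<open>r\<close> monomials, the basis element
  \<open>e\<^bsub>i\<^sub>0\<^esub> \<and> \<dots> \<and> e\<^bsub>i\<^sub>q\<^esub>\<close> with \<open>i\<^sub>0 < \<dots> < i\<^sub>q\<close> of the exterior power number \<open>q + 1\<close> is indexed by
  the set \<open>{i\<^sub>0, \<dots>, i\<^sub>q}\<close> of positions in \<open>us\<close>, counted from \<open>0\<close>. The position \<open>s\<close> of \<open>i\<close> in the
  wedge product is the number of smaller indices, and the quotient of two monomials is the difference
  of their exponent vectors. The formula for the differential does not depend on the degree \<open>q\<close>.\<close>

definition taylor_basis :: "'n monom list \<Rightarrow> nat \<Rightarrow> nat set set"
  where "taylor_basis us q = {A. A \<subseteq> {..<length us} \<and> card A = q + 1}"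

definition taylor_lcm :: "'n::finite monom list \<Rightarrow> nat set \<Rightarrow> 'n monom"
  where "taylor_lcm us A = lcm_monom ((!) us ` A)"

definition taylor_diff ::
    "'n::finite monom list \<Rightarrow>
     (nat set \<Rightarrow>\<^sub>0 ('n, 'k::field) mpoly) \<Rightarrow> (nat set \<Rightarrow>\<^sub>0 ('n, 'k) mpoly)"
  where "taylor_diff us = linear_extension (\<lambda>A. \<Sum>i\<in>A.
    fscale ((- 1) ^ card {j\<in>A. j < i} * mon (taylor_lcm us A - taylor_lcm us (A - {i})))
      (Poly_Mapping.single (A - {i}) 1))"

text \<open>The Taylor complex is always a free resolution, so its minimality is the condition on the
  differentials. The modules number \<open>r\<close> and higher, absent from the resolution, are zero here.\<close>

definition taylor_minimal :: "'k::field itself \<Rightarrow> 'n::finite monom list \<Rightarrow> bool"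
  where "taylor_minimal K us \<longleftrightarrow>
    minimal_differentials (taylor_basis us)
      ((\<lambda>_. taylor_diff us) ::
        nat \<Rightarrow> (nat set \<Rightarrow>\<^sub>0 ('n, 'k) mpoly) \<Rightarrow> (nat set \<Rightarrow>\<^sub>0 ('n, 'k) mpoly))"

end

theory Submission
  imports Defs
begin

section \<open>Monomials\<close>

text \<open>The nonzero entries of the Taylor differentials are signed monomials, the quotients of
  the lcm over a set of generators by the lcm over the set with one generator removed. So the
  resolution is minimal iff such a removal always changes the lcm
  (\<open>taylor_minimal_iff_lcm\<close>), which amounts to every generator u being dominant: some
  variable has a larger exponent in u than in each other generator
  (\<open>taylor_minimal_iff_dominant\<close>).

  A linear resolution has its first syzygies generated by linear ones. If u and v are the only
  generators dividing lcm(u,v), their Taylor syzygy cannot come from syzygies of smaller degree, so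
  lcm(u,v) has degree at most deg u + 1 (\<open>linear_resolution_mdeg_lcm_le\<close>). Dominance
  provides this situation for any two generators. Writing x(u) for the dominant variable of u, it
  follows that v x(u) = lcm(u,v) = u x(v), so the quotient u/x(u) is the same for all generators,
  and it is the monomial factor sought (\<open>dominant_linear_resolution_form\<close>).

  Conversely, in an ideal u (X_i : i in A) the generator u X_i is dominant at X_i, and the colon
  ideal of the generators with indices in a set A by a further generator u X_j is (X_i : i in A),
  which yields linear quotients (\<open>linear_quotients_mon_times_Var\<close>).\<close>

lemma lookup_mon: "Poly_Mapping.lookup (mon a) c = (if c = a then 1 else 0)"
  by (auto simp: mon_def lookup_single when_def)

lemma mon_times_mon: "mon a * mon b = mon (a + b)"
  by (simp add: mon_def mult_single)

lemma lookup_mon_times: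
  "Poly_Mapping.lookup (mon a * p) c = (\<Sum>q. (Poly_Mapping.lookup p q when c = a + q))"
proof -
  have "Poly_Mapping.lookup (mon a * p) c =
      (\<Sum>l. ((\<Sum>q. (Poly_Mapping.lookup p q when c = l + q)) when a = l))"
    by (simp add: lookup_mult mon_def lookup_single when_mult)
  then show ?thesis by simp
qed

lemma lookup_mon_times_add [simp]:
  "Poly_Mapping.lookup (mon a * p) (a + c) = Poly_Mapping.lookup p c"
  by (simp add: lookup_mon_times)

lemma lookup_mon_times_self [simp]:
  "Poly_Mapping.lookup (mon a * p) a = Poly_Mapping.lookup p 0"
  using lookup_mon_times_add[of a p 0] by simp

lemma lookup_mon_times_not_dvd:
  "(\<And>k. c \<noteq> a + k) \<Longrightarrow> Poly_Mapping.lookup (mon a * p) c = 0"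
  by (simp add: lookup_mon_times)

lemma keys_mon_times: "Poly_Mapping.keys (mon a * p) = (+) a ` Poly_Mapping.keys p"
proof (intro equalityI subsetI)
  fix c assume "c \<in> Poly_Mapping.keys (mon a * p)"
  then have "Poly_Mapping.lookup (mon a * p) c \<noteq> 0" by (simp add: in_keys_iff)
  then obtain k where "c = a + k" using lookup_mon_times_not_dvd by blast
  then show "c \<in> (+) a ` Poly_Mapping.keys p"
    using \<open>Poly_Mapping.lookup (mon a * p) c \<noteq> 0\<close> by (auto simp: in_keys_iff)
qed (auto simp: in_keys_iff)

lemma monom_dvd_iff:
  fixes a c :: "'n monom"
  shows "(\<exists>k. c = a + k) \<longleftrightarrow> (\<forall>x. Poly_Mapping.lookup a x \<le> Poly_Mapping.lookup c x)"
proof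
  assume "\<forall>x. Poly_Mapping.lookup a x \<le> Poly_Mapping.lookup c x"
  then have "c = a + (c - a)"
    by (intro poly_mapping_eqI) (simp add: lookup_add lookup_minus)
  then show "\<exists>k. c = a + k" ..
qed (auto simp: lookup_add)

lemma mdeg_add: "mdeg (a + b) = mdeg a + mdeg b"
  by (simp add: mdeg_def lookup_add sum.distrib)

lemma lookup_le_mdeg: "Poly_Mapping.lookup a x \<le> mdeg a"
  unfolding mdeg_def by (rule member_le_sum) auto

lemma mdeg_zero [simp]: "mdeg 0 = 0"
  by (simp add: mdeg_def)

lemma mdeg_eq_0_iff: "mdeg a = 0 \<longleftrightarrow> a = 0"
proof
  assume "mdeg a = 0"
  then show "a = 0" using lookup_le_mdeg[of a] by (intro poly_mapping_eqI) simp
qed (simp add: mdeg_def)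

lemma mdeg_single: "mdeg (Poly_Mapping.single x k) = k"
  by (simp add: mdeg_def lookup_single when_def)

lemma mdeg_mono:
  "(\<And>x. Poly_Mapping.lookup a x \<le> Poly_Mapping.lookup b x) \<Longrightarrow> mdeg a \<le> mdeg b"
  unfolding mdeg_def by (rule sum_mono) auto

lemma mdeg_eq_1D:
  assumes "mdeg a = 1" "Poly_Mapping.lookup a x \<noteq> 0"
  shows "a = Poly_Mapping.single x 1"
proof -
  obtain k where k: "a = Poly_Mapping.single x 1 + k"
    using assms(2) monom_dvd_iff[of a "Poly_Mapping.single x 1"]
    by (auto simp: lookup_single when_def)
  then have "mdeg k = 0" using assms(1) by (simp add: mdeg_add mdeg_single)
  then show ?thesis using k by (simp add: mdeg_eq_0_iff)
qed


section \<open>Monomial ideals\<close>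

lemma mon_mem_ideal_gen:
  "(mon c :: ('n::finite, 'k::field) mpoly) \<in> ideal_gen (mon ` M) \<longleftrightarrow> (\<exists>m\<in>M. \<exists>k. c = m + k)"
  unfolding mem_ideal_mon by (simp add: mon_def)

lemma ideal_gen_min_gens: "monomial_ideal I \<Longrightarrow> ideal_gen (mon ` min_gens I) = I"
  using minimal_monomial_generators_min_gens by (auto simp: minimal_monomial_generators_def)

text \<open>A proper subset omits some m of \<open>M\<close>; if it still generated, m would be a
  multiple of another element, against the antichain condition. Uniqueness of minimal generating
  sets does the rest.\<close>

lemma min_gens_eqI:
  fixes I :: "('n::finite, 'k::field) mpoly set"
  assumes gen: "ideal_gen (mon ` M) = I"
    and antichain: "\<And>m m' k. m \<in> M \<Longrightarrow> m' \<in> M \<Longrightarrow> m = m' + k \<Longrightarrow> m = m'"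
  shows "min_gens I = M"
proof -
  have I: "monomial_ideal I" using gen by (auto simp: monomial_ideal_def)
  have "minimal_monomial_generators I M"
    unfolding minimal_monomial_generators_def
  proof (intro conjI allI impI notI)
    fix M' assume M': "M' \<subset> M" "ideal_gen (mon ` M') = I"
    then obtain m where m: "m \<in> M" "m \<notin> M'" by blast
    then have "(mon m :: ('n, 'k) mpoly) \<in> ideal_gen (mon ` M)"
      by (auto simp: mon_mem_ideal_gen intro: exI[of _ 0] bexI[of _ m])
    then have "(mon m :: ('n, 'k) mpoly) \<in> ideal_gen (mon ` M')" using gen M' by simp
    then obtain m' k where "m' \<in> M'" "m = m' + k" by (auto simp: mon_mem_ideal_gen)
    with antichain[of m m' k] m M'(1) show False by blast
  qed (rule gen)
  then show ?thesis
    using minimal_monomial_generators_unique[OF I] minimal_monomial_generators_min_gens[OF I]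
    by blast
qed

section \<open>Monomial multiples of ideals generated by variables\<close>

lemma mon_times_ideal_gen:
  "(*) (mon u) ` ideal_gen (mon ` N) =
    (ideal_gen (mon ` ((+) u ` N)) :: ('n::finite, 'k::field) mpoly set)"
proof -
  have "module_hom (*) (*) ((*) (mon u) :: ('n, 'k) mpoly \<Rightarrow> _)"
    using module_times by (intro module_hom.intro) (auto intro: module_hom_axioms.intro simp: algebra_simps)
  from module_hom.span_image[OF this, of "mon ` N"]
  show ?thesis by (simp add: image_image mon_times_mon)
qed

lemma Var_image_eq: "Var ` A = mon ` ((\<lambda>x. Poly_Mapping.single x 1) ` A)"
  by (simp add: image_image Var_def)

lemma mon_times_ideal_gen_Var:
  "(*) (mon u) ` ideal_gen (Var ` A) =
    (ideal_gen (mon ` ((\<lambda>x. u + Poly_Mapping.single x 1) ` A)) :: ('n::finite, 'k::field) mpoly set)"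
  by (subst Var_image_eq, subst mon_times_ideal_gen) (simp add: image_image)

text \<open>The candidates all have degree \<open>mdeg u + 1\<close>, so divisibility between two of
  them is equality.\<close>

lemma min_gens_mon_times_Var:
  "min_gens ((*) (mon u) ` ideal_gen (Var ` A) :: ('n::finite, 'k::field) mpoly set) =
    (\<lambda>x. u + Poly_Mapping.single x 1) ` A"
proof (rule min_gens_eqI)
  fix m m' k
  assume m: "m \<in> (\<lambda>x. u + Poly_Mapping.single x 1) ` A"
    "m' \<in> (\<lambda>x. u + Poly_Mapping.single x 1) ` A" and k: "m = m' + k"
  from m have "mdeg m = mdeg m'" by (auto simp: mdeg_add mdeg_single)
  with k show "m = m'" by (simp add: mdeg_add mdeg_eq_0_iff)
qed (simp add: mon_times_ideal_gen_Var)

text \<open>Membership is decided monomial by monomial. After cancelling u, the variable y has to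
  divide the product of x and m; as y differs from x, it divides m.\<close>

lemma colon_ideal_mon_times_Var:
  assumes "x \<notin> A"
  shows "colon_ideal (ideal_gen (mon ` ((\<lambda>y. u + Poly_Mapping.single y 1) ` A)))
      (mon (u + Poly_Mapping.single x 1)) =
    (ideal_gen (Var ` A) :: ('n::finite, 'k::field) mpoly set)"
proof (intro set_eqI)
  fix g :: "('n, 'k) mpoly"
  have dvd: "(\<exists>k. u + Poly_Mapping.single x 1 + m = u + Poly_Mapping.single y 1 + k) \<longleftrightarrow>
      (\<exists>k. m = Poly_Mapping.single y 1 + k)" if "y \<in> A" for y m
    using that assms unfolding monom_dvd_iff
    by (auto simp: lookup_add lookup_single when_def split: if_splits)
  have "g \<in> colon_ideal (ideal_gen (mon ` ((\<lambda>y. u + Poly_Mapping.single y 1) ` A)))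
        (mon (u + Poly_Mapping.single x 1)) \<longleftrightarrow>
      (\<forall>m\<in>Poly_Mapping.keys g. \<exists>y\<in>A. \<exists>k.
        u + Poly_Mapping.single x 1 + m = u + Poly_Mapping.single y 1 + k)"
    by (simp add: colon_ideal_def mult.commute[of g] mem_ideal_mon keys_mon_times)
  also have "\<dots> \<longleftrightarrow> g \<in> ideal_gen (Var ` A)"
    unfolding Var_image_eq mem_ideal_mon by (auto simp: dvd[unfolded One_nat_def])
  finally show "g \<in> colon_ideal (ideal_gen (mon ` ((\<lambda>y. u + Poly_Mapping.single y 1) ` A)))
        (mon (u + Poly_Mapping.single x 1)) \<longleftrightarrow> g \<in> ideal_gen (Var ` A)" .
qed

lemma linear_quotients_mon_times_Var:
  fixes A :: "'n::finite set"
  shows "linear_quotients ((*) (mon u) ` ideal_gen (Var ` A) :: ('n, 'k::field) mpoly set)"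
proof -
  obtain xs where xs: "set xs = A" "distinct xs" using finite_distinct_list[of A] by auto
  define f where "f x = u + Poly_Mapping.single x 1" for x :: 'n
  \<comment> \<open>The variable is recovered as the only key of the factor left after cancelling
    u.\<close>
  have inj: "inj f"
    by (auto simp: f_def inj_on_def dest: arg_cong[where f = Poly_Mapping.keys])
  show ?thesis
    unfolding linear_quotients_def min_gens_mon_times_Var
  proof (intro exI[of _ "map f xs"] conjI allI impI)
    show "distinct (map f xs)"
      using xs(2) by (simp add: distinct_map inj_on_subset[OF inj])
    show "set (map f xs) = (\<lambda>x. u + Poly_Mapping.single x 1) ` A"
      using xs(1) by (simp add: f_def)
    fix j assume j: "j < length (map f xs)"
    then have "xs ! j \<notin> set (take j xs)"
      using xs(2) by (auto simp: in_set_conv_nth nth_eq_iff_index_eq)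
    from colon_ideal_mon_times_Var[OF this, of u]
    show "\<exists>A. colon_ideal (ideal_gen (mon ` set (take j (map f xs))))
        (mon (map f xs ! j) :: ('n, 'k) mpoly) = ideal_gen (Var ` A)"
      using j by (intro exI[of _ "set (take j xs)"]) (simp add: take_map f_def[abs_def])
  qed
qed


section \<open>Linear first syzygies\<close>

lemma single_in_free_mod: "b \<in> B \<Longrightarrow> Poly_Mapping.single b 1 \<in> free_mod B"
  by (simp add: free_mod_def)

lemma free_mod_expand:
  assumes "finite B" "v \<in> free_mod B"
  shows "v = (\<Sum>b\<in>B. fscale (Poly_Mapping.lookup v b) (Poly_Mapping.single b 1))"
proof (rule poly_mapping_eqI)
  fix c
  have "(\<Sum>b\<in>B. Poly_Mapping.lookup v b * (1 when b = c)) =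
      (\<Sum>b\<in>B. if b = c then Poly_Mapping.lookup v b else 0)"
    by (rule sum.cong) (auto simp: when_def)
  then show "Poly_Mapping.lookup v c = Poly_Mapping.lookup
      (\<Sum>b\<in>B. fscale (Poly_Mapping.lookup v b) (Poly_Mapping.single b 1)) c"
    using assms by (auto simp: lookup_sum lookup_single free_mod_def in_keys_iff)
qed

text \<open>Graded Nakayama: the basis element \<open>b\<close> cannot have degree below \<open>a\<close>, as the homogeneous elements
  of degree \<open>a\<close> would have coefficients without constant term at \<open>b\<close>, nor above \<open>a\<close>, as
  these coefficients would vanish.\<close>

lemma generated_in_degreeD:
  fixes B :: "'b set"
  assumes gen: "generated_in_degree (free_mod B :: ('b \<Rightarrow>\<^sub>0 ('n::finite, 'k::field) mpoly) set) dg a"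
    and b: "b \<in> B"
  shows "dg b = a"
proof (rule ccontr)
  assume neq: "dg b \<noteq> a"
  interpret module "fscale :: ('n, 'k) mpoly \<Rightarrow> ('b \<Rightarrow>\<^sub>0 ('n, 'k) mpoly) \<Rightarrow> _" by (rule module_fscale)
  let ?T = "{v :: 'b \<Rightarrow>\<^sub>0 ('n, 'k) mpoly. Poly_Mapping.lookup (Poly_Mapping.lookup v b) 0 = 0}"
  have "subspace ?T"
    unfolding subspace_def
  proof (intro conjI ballI allI)
    fix c :: "('n, 'k) mpoly" and v assume v: "v \<in> ?T"
    have "0 \<notin> Poly_Mapping.keys (c * Poly_Mapping.lookup v b)"
    proof
      assume "0 \<in> Poly_Mapping.keys (c * Poly_Mapping.lookup v b)"
      then obtain m n where mn: "0 = m + n" "n \<in> Poly_Mapping.keys (Poly_Mapping.lookup v b)"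
        using keys_mult[of c "Poly_Mapping.lookup v b"] by blast
      from arg_cong[OF mn(1), of mdeg] have "n = 0"
        by (simp add: mdeg_add mdeg_eq_0_iff)
      then show False using mn(2) v by (simp add: in_keys_iff)
    qed
    then show "fscale c v \<in> ?T" by (simp add: in_keys_iff)
  qed (auto simp: lookup_add)
  moreover have "{v \<in> free_mod B. homogeneous dg a v} \<subseteq> ?T"
  proof (safe, rule ccontr)
    fix v :: "'b \<Rightarrow>\<^sub>0 ('n, 'k) mpoly"
    assume v: "homogeneous dg a v" "Poly_Mapping.lookup (Poly_Mapping.lookup v b) 0 \<noteq> 0"
    then have "Poly_Mapping.lookup v b \<noteq> 0" by auto
    with v have "int (mdeg (0 :: 'n monom)) + dg b = a"
      by (force simp: homogeneous_def in_keys_iff)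
    then show False using neq by (simp add: mdeg_def)
  qed
  ultimately have "free_mod B \<subseteq> ?T"
    using gen span_minimal unfolding generated_in_degree_def by blast
  moreover have "Poly_Mapping.single b 1 \<in> (free_mod B :: ('b \<Rightarrow>\<^sub>0 ('n, 'k) mpoly) set)"
    using b by (rule single_in_free_mod)
  ultimately show False by (auto simp: lookup_one)
qed

text \<open>Compare coefficients at \<open>u + n\<close>: the summand of w contains only multiples
  of w, so by \<open>ndvd\<close> only the summand of u contributes, and its contribution is the
  coefficient of \<open>s u\<close> at n.\<close>

lemma syzygy_coeff_eq_0:
  fixes s :: "'n::finite monom \<Rightarrow> ('n, 'k::field) mpoly"
  assumes "finite M" "u \<in> M" and syz: "(\<Sum>w\<in>M. s w * mon w) = 0"
    and ndvd: "\<And>w k. w \<in> M \<Longrightarrow> u + n = w + k \<Longrightarrow> w = u"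
  shows "Poly_Mapping.lookup (s u) n = 0"
proof -
  have "0 = (\<Sum>w\<in>M. Poly_Mapping.lookup (mon w * s w) (u + n))"
    using arg_cong[OF syz, of "\<lambda>p. Poly_Mapping.lookup p (u + n)"]
    by (simp add: lookup_sum mult.commute)
  also have "\<dots> = (\<Sum>w\<in>M. if w = u then Poly_Mapping.lookup (s u) n else 0)"
    by (rule sum.cong) (auto intro!: lookup_mon_times_not_dvd dest: ndvd)
  finally show ?thesis using assms(1,2) by simp
qed

lemma lookup_lcm_pair:
  "Poly_Mapping.lookup (lcm_monom {u, v}) x = max (Poly_Mapping.lookup u x) (Poly_Mapping.lookup v x)"
  by (simp add: lookup_lcm_monom)

text \<open>If \<open>u\<close> and \<open>v\<close> are the only generators dividing their least common multiple \<open>L\<close>, their Taylor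
  syzygy is not a combination of syzygies of smaller degree. To see this without comparing resolutions,
  factor \<open>\<epsilon>\<close> through the free module on the generators (by the maps \<open>\<phi> w\<close>) and read off the
  coefficient of \<open>L / u\<close> in the component of \<open>u\<close>: it is \<open>1\<close> on the Taylor syzygy, and \<open>0\<close> on
  all multiples of linear syzygies if the degree of \<open>L / u\<close> exceeds \<open>1\<close>.\<close>

lemma linear_resolution_mdeg_lcm_le:
  fixes I :: "('n::finite, 'k::field) mpoly set"
  assumes I: "monomial_ideal I" and lin: "linear_resolution I"
    and u: "u \<in> min_gens I" and v: "v \<in> min_gens I" and "u \<noteq> v"
    and only: "\<And>w k. w \<in> min_gens I \<Longrightarrow> lcm_monom {u, v} = w + k \<Longrightarrow> w = u \<or> w = v"
  shows "mdeg (lcm_monom {u, v}) \<le> mdeg u + 1"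
proof (rule ccontr)
  define M where "M = min_gens I"
  define L where "L = lcm_monom {u, v}"
  assume "\<not> mdeg (lcm_monom {u, v}) \<le> mdeg u + 1"
  then have big: "mdeg L > mdeg u + 1" by (simp add: L_def)
  have uM: "u \<in> M" and vM: "v \<in> M" using u v by (auto simp: M_def)
  have gen: "ideal_gen (mon ` M) = I" using ideal_gen_min_gens[OF I] by (simp add: M_def)
  have fin: "finite M" using linear_resolution_enumeration[OF lin] List.finite_set unfolding M_def by metis
  obtain a where a: "L = u + a" using monom_dvd_iff[of L u] by (auto simp: L_def lookup_lcm_pair)
  obtain b where b: "L = v + b" using monom_dvd_iff[of L v] by (auto simp: L_def lookup_lcm_pair)
  obtain e :: nat and B :: "nat \<Rightarrow> nat set" and dg d \<epsilon> where
    e: "\<And>w. w \<in> M \<Longrightarrow> mdeg w = e" and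
    res: "graded_free_resolution I B dg d \<epsilon>" and
    deg: "\<And>q. generated_in_degree (free_mod (B q) :: (nat \<Rightarrow>\<^sub>0 ('n, 'k) mpoly) set)
               (dg q) (int e + int q)"
    using lin unfolding linear_resolution_def M_def by blast
  note res' = res[unfolded graded_free_resolution_def]
  have finB: "finite (B q)" for q using res' by simp
  have hom\<epsilon>: "module_hom fscale (*) \<epsilon>" using res' by simp
  have homd: "module_hom fscale fscale (d 1)" using res' by simp
  have \<epsilon>_deg: "int (mdeg m) = dg 0 b"
    if "b \<in> B 0" "m \<in> Poly_Mapping.keys (\<epsilon> (Poly_Mapping.single b 1))" for b m
    using res' that by simp
  have d_deg: "homogeneous (dg 0) (dg 1 b) (d 1 (Poly_Mapping.single b 1))" if "b \<in> B 1" for b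
    using res' that by simp
  have \<epsilon>_onto: "\<epsilon> ` free_mod (B 0) = I" using res' by blast
  have d_onto: "d 1 ` free_mod (B 1) = {v \<in> free_mod (B 0). \<epsilon> v = 0}" using res' by blast
  interpret \<epsilon>: module_hom fscale "(*)" \<epsilon> by (rule hom\<epsilon>)
  interpret d: module_hom fscale fscale "d 1" by (rule homd)
  have dg: "dg q b = int e + int q" if "b \<in> B q" for q b
    using generated_in_degreeD[OF deg that] .
  have antichain: "w = w'" if "w \<in> M" "w' \<in> M" "w = w' + k" for w w' k
    using that e[of w] e[of w'] by (simp add: mdeg_add mdeg_eq_0_iff)

  \<comment> \<open>The image of a basis element is homogeneous of degree e and lies in I; the
    monomials of degree e in I are exactly the generators.\<close>
  have \<epsilon>_keys: "Poly_Mapping.keys (\<epsilon> (Poly_Mapping.single y 1)) \<subseteq> M" if y: "y \<in> B 0" for y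
  proof
    fix m assume m: "m \<in> Poly_Mapping.keys (\<epsilon> (Poly_Mapping.single y 1))"
    have "\<epsilon> (Poly_Mapping.single y 1) \<in> ideal_gen (mon ` M)"
      using \<epsilon>_onto single_in_free_mod[OF y] gen by blast
    then obtain m' k where mk: "m' \<in> M" "m = m' + k" using m by (auto simp: mem_ideal_mon)
    moreover have "mdeg m = e" using \<epsilon>_deg[OF y m] dg[OF y] by simp
    ultimately show "m \<in> M" using e by (simp add: mdeg_add mdeg_eq_0_iff)
  qed
  \<comment> \<open>Hence \<epsilon> sends basis elements to combinations of generators with
    coefficients in the field. These are kept as constant polynomials, so that \<open>\<phi>\<close>
    does not raise degrees.\<close>
  define c where "c w y = (Poly_Mapping.single 0 (Poly_Mapping.lookup (\<epsilon> (Poly_Mapping.single y 1)) w)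
    :: ('n, 'k) mpoly)" for w y
  have \<epsilon>_single: "\<epsilon> (Poly_Mapping.single y 1) = (\<Sum>w\<in>M. c w y * mon w)" if y: "y \<in> B 0" for y
  proof (rule poly_mapping_eqI)
    fix m
    have "(\<Sum>w\<in>M. Poly_Mapping.lookup (c w y * mon w) m) =
        (\<Sum>w\<in>M. if w = m then Poly_Mapping.lookup (\<epsilon> (Poly_Mapping.single y 1)) m else 0)"
      by (rule sum.cong) (auto simp: c_def mon_def mult_single lookup_single when_def)
    then show "Poly_Mapping.lookup (\<epsilon> (Poly_Mapping.single y 1)) m =
        Poly_Mapping.lookup (\<Sum>w\<in>M. c w y * mon w) m"
      using fin \<epsilon>_keys[OF y] by (auto simp: lookup_sum in_keys_iff)
  qed
  define \<phi> where "\<phi> w x = (\<Sum>y\<in>B 0. Poly_Mapping.lookup x y * c w y)" for w x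
  have hom\<phi>: "module_hom fscale (*) (\<phi> w)" for w
  proof (intro module_hom.intro module_fscale module_times module_hom_axioms.intro)
    show "\<phi> w (x + y) = \<phi> w x + \<phi> w y" for x y
      by (simp add: \<phi>_def lookup_add distrib_right sum.distrib)
    show "\<phi> w (fscale p x) = p * \<phi> w x" for p x
      by (simp only: \<phi>_def lookup_fscale sum_distrib_left mult.assoc)
  qed
  interpret \<phi>: module_hom fscale "(*)" "\<phi> u" by (rule hom\<phi>)
  have \<epsilon>_\<phi>: "\<epsilon> x = (\<Sum>w\<in>M. \<phi> w x * mon w)" if x: "x \<in> free_mod (B 0)" for x
  proof -
    have "\<epsilon> x = (\<Sum>y\<in>B 0. Poly_Mapping.lookup x y * \<epsilon> (Poly_Mapping.single y 1))"
      by (subst free_mod_expand[OF finB x]) (simp add: \<epsilon>.sum \<epsilon>.scale)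
    also have "\<dots> = (\<Sum>y\<in>B 0. \<Sum>w\<in>M. Poly_Mapping.lookup x y * c w y * mon w)"
      by (intro sum.cong refl) (simp only: \<epsilon>_single sum_distrib_left mult.assoc)
    also have "\<dots> = (\<Sum>w\<in>M. \<phi> w x * mon w)"
      by (subst sum.swap) (simp add: \<phi>_def sum_distrib_right)
    finally show ?thesis .
  qed
  have lift: "\<exists>x\<in>free_mod (B 0). \<epsilon> x = mon w \<and> Poly_Mapping.lookup (\<phi> w x) 0 = 1"
    if w: "w \<in> M" for w
  proof -
    have "mon w \<in> I" using w gen \<epsilon>.m2.span_base by blast
    then obtain x where x: "x \<in> free_mod (B 0)" "\<epsilon> x = mon w" using \<epsilon>_onto by force
    \<comment> \<open>No other generator divides w, so the coefficient of w in
      \<open>\<epsilon> x\<close> comes from the constant term of \<open>\<phi> w x\<close>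
      alone.\<close>
    have "1 = (\<Sum>w'\<in>M. Poly_Mapping.lookup (mon w' * \<phi> w' x) w)"
      using arg_cong[OF \<epsilon>_\<phi>[OF x(1)], of "\<lambda>p. Poly_Mapping.lookup p w"] x(2)
      by (simp add: lookup_sum lookup_mon mult.commute)
    also have "\<dots> = (\<Sum>w'\<in>M. if w' = w then Poly_Mapping.lookup (\<phi> w x) 0 else 0)"
      using antichain w by (intro sum.cong) (auto intro!: lookup_mon_times_not_dvd)
    finally show ?thesis using fin w x by auto
  qed
  obtain fu where fu: "fu \<in> free_mod (B 0)" "\<epsilon> fu = mon u" "Poly_Mapping.lookup (\<phi> u fu) 0 = 1"
    using lift[OF uM] by blast
  obtain fv where fv: "fv \<in> free_mod (B 0)" "\<epsilon> fv = mon v"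
    using lift[OF vM] by blast
  \<comment> \<open>A preimage of the Taylor syzygy of u and v: here a is L/u and b is L/v, so
    \<epsilon> maps g to L - L.\<close>
  define g where "g = fscale (mon a) fu - fscale (mon b) fv"
  \<comment> \<open>The part coming from v cannot disturb the coefficient at a: if b divided a, then
    u would divide v.\<close>
  have "Poly_Mapping.lookup (mon b * \<phi> u fv) a = 0"
  proof (rule lookup_mon_times_not_dvd)
    fix k show "a \<noteq> b + k"
    proof
      assume "a = b + k"
      then have "v + b = u + k + b" using a b by (simp add: ac_simps)
      then have "v = u + k" by simp
      then show False using antichain[OF vM uM] \<open>u \<noteq> v\<close> by simp
    qed
  qed
  then have g1: "Poly_Mapping.lookup (\<phi> u g) a = 1"
    by (simp add: g_def \<phi>.diff \<phi>.scale lookup_minus fu)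
  have "\<epsilon> g = 0"
    using a b by (simp add: g_def \<epsilon>.diff \<epsilon>.scale fu fv mon_times_mon add.commute)
  moreover have "g \<in> free_mod (B 0)"
  proof -
    have "Poly_Mapping.lookup fu y = 0" "Poly_Mapping.lookup fv y = 0" if "y \<notin> B 0" for y
      using fu(1) fv(1) that by (auto simp: free_mod_def in_keys_iff)
    then have "Poly_Mapping.lookup g y = 0" if "y \<notin> B 0" for y
      using that by (simp add: g_def lookup_minus)
    then show ?thesis by (auto simp: free_mod_def in_keys_iff)
  qed
  ultimately have "g \<in> d 1 ` free_mod (B 1)" unfolding d_onto by blast
  then obtain x where x: "x \<in> free_mod (B 1)" "g = d 1 x" by blast
  have "\<phi> u g = (\<Sum>y\<in>B 1. Poly_Mapping.lookup x y * \<phi> u (d 1 (Poly_Mapping.single y 1)))"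
    unfolding x(2) by (subst free_mod_expand[OF finB x(1)]) (simp only: d.sum d.scale \<phi>.sum \<phi>.scale)
  moreover have "Poly_Mapping.lookup (Poly_Mapping.lookup x y * \<phi> u (d 1 (Poly_Mapping.single y 1))) a = 0"
    if y: "y \<in> B 1" for y
  proof (rule ccontr)
    define z where "z = d 1 (Poly_Mapping.single y 1)"
    assume "Poly_Mapping.lookup (Poly_Mapping.lookup x y * \<phi> u (d 1 (Poly_Mapping.single y 1))) a \<noteq> 0"
    then have "a \<in> Poly_Mapping.keys (Poly_Mapping.lookup x y * \<phi> u z)"
      by (simp add: z_def in_keys_iff)
    then obtain m n where mn: "a = m + n" "n \<in> Poly_Mapping.keys (\<phi> u z)"
      using keys_mult[of "Poly_Mapping.lookup x y" "\<phi> u z"] by blast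
    have "z \<in> d 1 ` free_mod (B 1)" unfolding z_def using single_in_free_mod[OF y] by blast
    then have z: "z \<in> free_mod (B 0)" "\<epsilon> z = 0" using d_onto by auto
    have "Poly_Mapping.lookup (\<phi> u z) n \<noteq> 0" using mn(2) by (simp add: in_keys_iff)
    then obtain y' where y': "y' \<in> B 0" "Poly_Mapping.lookup (Poly_Mapping.lookup z y' * c u y') n \<noteq> 0"
      unfolding \<phi>_def lookup_sum by (metis (mono_tags, lifting) sum.neutral)
    then have "n \<in> Poly_Mapping.keys (Poly_Mapping.lookup z y' * c u y')" by (simp add: in_keys_iff)
    then obtain n' k where "n = n' + k" "n' \<in> Poly_Mapping.keys (Poly_Mapping.lookup z y')"
        "k \<in> Poly_Mapping.keys (c u y')"
      using keys_mult[of "Poly_Mapping.lookup z y'" "c u y'"] by blast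
    \<comment> \<open>The factor k is trivial, as \<open>c u y'\<close> is a constant.\<close>
    then have n: "n \<in> Poly_Mapping.keys (Poly_Mapping.lookup z y')"
      by (auto simp: c_def split: if_splits)
    then have "y' \<in> Poly_Mapping.keys z" by (auto simp: in_keys_iff)
    then have "int (mdeg n) + dg 0 y' = dg 1 y"
      using d_deg[OF y] n unfolding homogeneous_def z_def by blast
    then have n1: "mdeg n = 1" using dg[OF y] dg[OF y'(1)] by simp
    \<comment> \<open>A generator dividing \<open>u + n\<close> divides L, so it is u or v. If it
      were v, then L would divide \<open>u + n\<close>, whose degree \<open>mdeg u + 1\<close> is
      too small.\<close>
    have "Poly_Mapping.lookup (\<phi> u z) n = 0"
    proof (rule syzygy_coeff_eq_0[OF fin uM])
      show "(\<Sum>w\<in>M. \<phi> w z * mon w) = 0" using \<epsilon>_\<phi>[OF z(1)] z(2) by simp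
      fix w k assume w: "w \<in> M" and k: "u + n = w + k"
      have "L = w + (k + m)" using a mn(1) k by (metis add.assoc add.commute)
      then have "w = u \<or> w = v" using only w by (simp add: L_def M_def)
      moreover have "w \<noteq> v"
      proof
        assume "w = v"
        then have "Poly_Mapping.lookup v x \<le> Poly_Mapping.lookup (u + n) x" for x
          by (simp only: k lookup_add)
        then have "Poly_Mapping.lookup L x \<le> Poly_Mapping.lookup (u + n) x" for x
          by (simp add: L_def lookup_lcm_pair lookup_add)
        then show False using mdeg_mono[of L "u + n"] big n1 by (simp add: mdeg_add)
      qed
      ultimately show "w = u" by blast
    qed
    then show False using mn(2) by (simp add: in_keys_iff)
  qed
  ultimately show False using g1 by (simp add: lookup_sum)
qed


section \<open>Minimality of the Taylor resolution\<close>

text \<open>The vectors whose coefficient at b lies in the ideal of all variables form a submodule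
  that contains the products spanning \<open>ideal_times\<close>.\<close>

lemma lookup_ideal_times_maximal:
  fixes v :: "'b \<Rightarrow>\<^sub>0 ('n::finite, 'k::field) mpoly"
  assumes "v \<in> ideal_times (ideal_gen (range Var)) F"
  shows "Poly_Mapping.lookup v b \<in> ideal_gen (range Var)"
proof -
  interpret r: module "(*) :: ('n, 'k) mpoly \<Rightarrow> _" by (rule module_times)
  interpret module "fscale :: ('n, 'k) mpoly \<Rightarrow> ('b \<Rightarrow>\<^sub>0 ('n, 'k) mpoly) \<Rightarrow> _" by (rule module_fscale)
  have "subspace {v. Poly_Mapping.lookup v b \<in> ideal_gen (range Var :: ('n, 'k) mpoly set)}"
    by (auto simp: subspace_def lookup_add r.span_zero r.span_add r.span_scale)
  moreover have "{fscale a v | a v. a \<in> ideal_gen (range Var) \<and> v \<in> F} \<subseteq>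
      {v. Poly_Mapping.lookup v b \<in> ideal_gen (range Var)}"
  proof clarsimp
    fix a :: "('n, 'k) mpoly" and v :: "'b \<Rightarrow>\<^sub>0 ('n, 'k) mpoly"
    assume "a \<in> ideal_gen (range Var)"
    from r.span_scale[OF this, of "Poly_Mapping.lookup v b"]
    show "a * Poly_Mapping.lookup v b \<in> ideal_gen (range Var)" by (simp add: mult.commute)
  qed
  ultimately show ?thesis
    using assms span_minimal unfolding ideal_times_def by blast
qed

lemma mon_mem_maximal:
  "(mon m :: ('n::finite, 'k::field) mpoly) \<in> ideal_gen (range Var) \<longleftrightarrow> m \<noteq> 0"
proof -
  have "(\<exists>x. \<exists>k. m = Poly_Mapping.single x 1 + k) \<longleftrightarrow> (\<exists>x. Poly_Mapping.lookup m x \<noteq> 0)"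
    unfolding monom_dvd_iff by (auto simp: lookup_single when_def Suc_le_eq)
  also have "\<dots> \<longleftrightarrow> m \<noteq> 0"
    by (metis lookup_zero poly_mapping_eqI)
  finally show ?thesis by (simp add: Var_image_eq mon_mem_ideal_gen)
qed

section \<open>Entries of the Taylor differential\<close>

lemma lookup_taylor_diff_single:
  assumes "finite A" "i \<in> A"
  shows "Poly_Mapping.lookup (taylor_diff us (Poly_Mapping.single A 1) ::
      nat set \<Rightarrow>\<^sub>0 ('n::finite, 'k::field) mpoly) (A - {i}) =
    (- 1) ^ card {j\<in>A. j < i} * mon (taylor_lcm us A - taylor_lcm us (A - {i}))"
    (is "_ = ?c i")
proof -
  have "Poly_Mapping.lookup (taylor_diff us (Poly_Mapping.single A 1) ::
      nat set \<Rightarrow>\<^sub>0 ('n, 'k) mpoly) (A - {i}) =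
      (\<Sum>l\<in>A. ?c l * (1 when A - {l} = A - {i}))"
    by (simp add: taylor_diff_def linear_extension_def lookup_sum lookup_single)
  also have "\<dots> = (\<Sum>l\<in>A. if l = i then ?c i else 0)"
    using assms(2) by (intro sum.cong) (auto simp: when_def)
  finally show ?thesis using assms by simp
qed

lemma lookup_taylor_lcm_mono:
  assumes "finite A" "A' \<subseteq> A" "A' \<noteq> {}"
  shows "Poly_Mapping.lookup (taylor_lcm us A') x \<le> Poly_Mapping.lookup (taylor_lcm us A) x"
  unfolding taylor_lcm_def lookup_lcm_monom using assms by (intro Max_mono) auto

text \<open>Subtraction of exponents truncates at 0, so a zero difference gives only one inequality;
  the other is monotonicity of the lcm, for which the smaller set must be nonempty.\<close>

lemma taylor_lcm_diff_eq_0_iff: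
  assumes "finite A" "A - {i} \<noteq> {}"
  shows "taylor_lcm us A - taylor_lcm us (A - {i}) = 0 \<longleftrightarrow> taylor_lcm us A = taylor_lcm us (A - {i})"
proof -
  have "Poly_Mapping.lookup (taylor_lcm us (A - {i})) x \<le> Poly_Mapping.lookup (taylor_lcm us A) x" for x
    using assms by (intro lookup_taylor_lcm_mono) auto
  then show ?thesis
    by (force simp: poly_mapping_eq_iff fun_eq_iff lookup_minus intro: antisym)
qed

text \<open>A signed monomial lies in the ideal of all variables iff the monomial is not 1, that is,
  iff the two lcms differ. Requiring \<open>A - {i}\<close> to be nonempty leaves out the
  augmentation.\<close>

lemma taylor_minimal_iff_lcm:
  "taylor_minimal TYPE('k::field) (us :: 'n::finite monom list) \<longleftrightarrow>
    (\<forall>A \<subseteq> {..<length us}. \<forall>i\<in>A. A - {i} \<noteq> {} \<longrightarrow> taylor_lcm us A \<noteq> taylor_lcm us (A - {i}))"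
proof
  assume min: "taylor_minimal TYPE('k) us"
  show "\<forall>A \<subseteq> {..<length us}. \<forall>i\<in>A. A - {i} \<noteq> {} \<longrightarrow> taylor_lcm us A \<noteq> taylor_lcm us (A - {i})"
  proof (intro allI ballI impI)
    fix A i assume A: "A \<subseteq> {..<length us}" and i: "i \<in> A" and ne: "A - {i} \<noteq> {}"
    let ?c = "(- 1) ^ card {j\<in>A. j < i} :: ('n, 'k) mpoly"
    let ?m = "taylor_lcm us A - taylor_lcm us (A - {i})"
    interpret module "(*) :: ('n, 'k) mpoly \<Rightarrow> _" by (rule module_times)
    have finA: "finite A" using A finite_subset by blast
    have "card (A - {i}) \<noteq> 0" using finA ne by (subst card_0_eq) auto
    then obtain q where "card A = Suc q + 1"
      using card.remove[OF finA i] by (metis Suc_eq_plus1 not0_implies_Suc)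
    then have "Poly_Mapping.single A 1 \<in> free_mod (taylor_basis us (Suc q))"
      using A by (intro single_in_free_mod) (simp add: taylor_basis_def)
    then have "taylor_diff us (Poly_Mapping.single A 1 :: nat set \<Rightarrow>\<^sub>0 ('n, 'k) mpoly)
        \<in> ideal_times (ideal_gen (range Var)) (free_mod (taylor_basis us q))"
      using min unfolding taylor_minimal_def minimal_differentials_def by blast
    from lookup_ideal_times_maximal[OF this, of "A - {i}"]
    have "?c * mon ?m \<in> ideal_gen (range Var)"
      by (simp add: lookup_taylor_diff_single[OF finA i])
    \<comment> \<open>A second multiplication by the sign removes it, since its square is 1.\<close>
    from span_scale[OF this, of ?c] have "mon ?m \<in> ideal_gen (range Var :: ('n, 'k) mpoly set)"
      by (simp flip: mult.assoc power_mult_distrib)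
    then show "taylor_lcm us A \<noteq> taylor_lcm us (A - {i})"
      using taylor_lcm_diff_eq_0_iff[OF finA ne, of us] by (simp add: mon_mem_maximal)
  qed
next
  assume neq: "\<forall>A \<subseteq> {..<length us}. \<forall>i\<in>A. A - {i} \<noteq> {} \<longrightarrow>
    taylor_lcm us A \<noteq> taylor_lcm us (A - {i})"
  show "taylor_minimal TYPE('k) us"
    unfolding taylor_minimal_def minimal_differentials_def
  proof (intro allI subsetI, elim imageE)
    fix q and w v :: "nat set \<Rightarrow>\<^sub>0 ('n, 'k) mpoly"
    assume v: "v \<in> free_mod (taylor_basis us (Suc q))" and w: "w = taylor_diff us v"
    interpret r: module "(*) :: ('n, 'k) mpoly \<Rightarrow> _" by (rule module_times)
    interpret module "fscale :: ('n, 'k) mpoly \<Rightarrow> (nat set \<Rightarrow>\<^sub>0 ('n, 'k) mpoly) \<Rightarrow> _"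
      by (rule module_fscale)
    show "w \<in> ideal_times (ideal_gen (range Var)) (free_mod (taylor_basis us q))"
      unfolding w taylor_diff_def linear_extension_def ideal_times_def
    proof (rule span_sum, rule span_scale, rule span_sum)
      fix A i assume "A \<in> Poly_Mapping.keys v" and i: "i \<in> A"
      then have A: "A \<subseteq> {..<length us}" "card A = Suc (Suc q)"
        using v by (auto simp: free_mod_def taylor_basis_def)
      then have finA: "finite A" using finite_subset by blast
      then have card: "card (A - {i}) = Suc q" using i A by simp
      then have ne: "A - {i} \<noteq> {}" by (metis card.empty nat.distinct(1))
      have "mon (taylor_lcm us A - taylor_lcm us (A - {i})) \<in> ideal_gen (range Var :: ('n, 'k) mpoly set)"
        using neq A i ne taylor_lcm_diff_eq_0_iff[OF finA ne, of us] by (simp add: mon_mem_maximal)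
      moreover have "A - {i} \<in> taylor_basis us q"
        using A card by (auto simp: taylor_basis_def)
      ultimately show "fscale ((- 1) ^ card {j\<in>A. j < i} * mon (taylor_lcm us A - taylor_lcm us (A - {i})))
          (Poly_Mapping.single (A - {i}) 1) \<in> span {fscale a v | a v.
            a \<in> ideal_gen (range Var) \<and> v \<in> free_mod (taylor_basis us q)}"
        by (blast intro: span_base r.span_scale single_in_free_mod)
    qed
  qed
qed

text \<open>A dominant variable of a generator shows that the lcm drops on its removal from any set.
  In the other direction the set of all positions suffices: a variable at which the lcm drops when u
  is removed is dominant for u.\<close>

lemma taylor_minimal_iff_dominant:
  assumes "distinct us"
  shows "taylor_minimal TYPE('k::field) (us :: 'n::finite monom list) \<longleftrightarrow>
    (\<forall>u\<in>set us. \<exists>x. \<forall>v\<in>set us - {u}. Poly_Mapping.lookup v x < Poly_Mapping.lookup u x)"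
    (is "_ \<longleftrightarrow> ?dominant")
proof -
  have "?dominant \<longleftrightarrow> (\<forall>A \<subseteq> {..<length us}. \<forall>i\<in>A. A - {i} \<noteq> {} \<longrightarrow>
      taylor_lcm us A \<noteq> taylor_lcm us (A - {i}))" (is "_ \<longleftrightarrow> ?lcm")
  proof
    assume dom: ?dominant
    show ?lcm
    proof (intro allI ballI impI notI)
      fix A i assume A: "A \<subseteq> {..<length us}" "i \<in> A" "A - {i} \<noteq> {}"
        and eq: "taylor_lcm us A = taylor_lcm us (A - {i})"
      then have finA: "finite A" using finite_subset by blast
      have "us ! i \<in> set us" using A by auto
      with dom obtain x where x: "\<And>v. v \<in> set us \<Longrightarrow> v \<noteq> us ! i \<Longrightarrow>
          Poly_Mapping.lookup v x < Poly_Mapping.lookup (us ! i) x"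
        by blast
      have "Poly_Mapping.lookup (taylor_lcm us (A - {i})) x < Poly_Mapping.lookup (us ! i) x"
        unfolding taylor_lcm_def lookup_lcm_monom
        using A finA assms by (subst Max_less_iff) (auto intro!: x simp: nth_eq_iff_index_eq subset_iff)
      also have "\<dots> \<le> Poly_Mapping.lookup (taylor_lcm us A) x"
        unfolding taylor_lcm_def lookup_lcm_monom using A finA by (intro Max_ge) auto
      finally show False using eq by simp
    qed
  next
    assume lcm: ?lcm
    show ?dominant
    proof
      fix u assume "u \<in> set us"
      then obtain i where i: "i < length us" "u = us ! i" by (auto simp: in_set_conv_nth)
      let ?A = "{..<length us}"
      show "\<exists>x. \<forall>v\<in>set us - {u}. Poly_Mapping.lookup v x < Poly_Mapping.lookup u x"
      proof (cases "?A - {i} = {}")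
        case True
        then have "set us - {u} = {}" using i by (auto simp: in_set_conv_nth)
        then show ?thesis by (metis empty_iff)
      next
        case False
        then have "taylor_lcm us ?A \<noteq> taylor_lcm us (?A - {i})" using lcm i by blast
        then obtain x where x: "Poly_Mapping.lookup (taylor_lcm us ?A) x \<noteq>
            Poly_Mapping.lookup (taylor_lcm us (?A - {i})) x"
          by (metis poly_mapping_eqI)
        have "(!) us ` ?A = insert u ((!) us ` (?A - {i}))" using i by auto
        then have "Poly_Mapping.lookup (taylor_lcm us ?A) x =
            max (Poly_Mapping.lookup u x) (Poly_Mapping.lookup (taylor_lcm us (?A - {i})) x)"
          using False unfolding taylor_lcm_def lookup_lcm_monom
          by (simp only: image_insert) (subst Max_insert; auto)
        with x have "Poly_Mapping.lookup (taylor_lcm us (?A - {i})) x < Poly_Mapping.lookup u x"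
          by linarith
        moreover have "Poly_Mapping.lookup v x \<le> Poly_Mapping.lookup (taylor_lcm us (?A - {i})) x"
          if "v \<in> set us - {u}" for v
          using that i unfolding taylor_lcm_def lookup_lcm_monom
          by (intro Max_ge) (auto simp: in_set_conv_nth)
        ultimately show ?thesis by (meson le_less_trans)
      qed
    qed
  qed
  then show ?thesis by (simp add: taylor_minimal_iff_lcm)
qed


section \<open>The equivalence\<close>

text \<open>Each generator \<open>u\<close> has a variable \<open>\<xi> u\<close> whose exponent exceeds those in all other generators, so no third
  generator divides the least common multiple of two of them, which therefore has degree one more than the
  generators. Hence \<open>u / \<xi> u = v / \<xi> v\<close> for any two generators.\<close>

lemma dominant_linear_resolution_form:
  fixes I :: "('n::finite, 'k::field) mpoly set"
  assumes I: "monomial_ideal I" "I \<noteq> {0}" "I \<noteq> UNIV" and lin: "linear_resolution I"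
    and dom: "\<forall>u\<in>min_gens I. \<exists>x. \<forall>v\<in>min_gens I - {u}. Poly_Mapping.lookup v x < Poly_Mapping.lookup u x"
  shows "\<exists>A u. A \<noteq> {} \<and> I = (*) (mon u) ` ideal_gen (Var ` A)"
proof -
  define M where "M = min_gens I"
  have gen: "ideal_gen (mon ` M) = I" using ideal_gen_min_gens[OF I(1)] by (simp add: M_def)
  obtain e where e: "\<And>w. w \<in> M \<Longrightarrow> mdeg w = e"
    using lin unfolding linear_resolution_def M_def by blast
  have "M \<noteq> {}" using gen I(2) module.span_empty[OF module_times] by fastforce
  have "0 \<notin> M"
  proof
    assume "0 \<in> M"
    then have "f \<in> ideal_gen (mon ` M)" for f :: "('n, 'k) mpoly"
      unfolding mem_ideal_mon by (metis add_0)
    then show False using gen I(3) by blast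
  qed
  \<comment> \<open>The dominant variable should also divide u. With a second generator this follows
    from the strict inequality; for a single generator dominance is vacuous, and I being proper
    supplies a variable dividing u.\<close>
  have "\<exists>x. Poly_Mapping.lookup u x \<noteq> 0 \<and>
      (\<forall>v\<in>M - {u}. Poly_Mapping.lookup v x < Poly_Mapping.lookup u x)" if u: "u \<in> M" for u
  proof (cases "M = {u}")
    case True
    then have "u \<noteq> 0" using \<open>0 \<notin> M\<close> by blast
    then have "\<exists>x. Poly_Mapping.lookup u x \<noteq> 0" by (metis lookup_zero poly_mapping_eqI)
    then show ?thesis using True by auto
  next
    case False
    then obtain v where v: "v \<in> M - {u}" using u by blast
    obtain x where x: "\<forall>v\<in>M - {u}. Poly_Mapping.lookup v x < Poly_Mapping.lookup u x"
      using dom u unfolding M_def by blast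
    then have "Poly_Mapping.lookup u x \<noteq> 0" using v by fastforce
    with x show ?thesis by blast
  qed
  then obtain \<xi> where \<xi>0: "\<And>u. u \<in> M \<Longrightarrow> Poly_Mapping.lookup u (\<xi> u) \<noteq> 0"
    and \<xi>: "\<And>u v. u \<in> M \<Longrightarrow> v \<in> M \<Longrightarrow> v \<noteq> u \<Longrightarrow>
      Poly_Mapping.lookup v (\<xi> u) < Poly_Mapping.lookup u (\<xi> u)"
    by (metis DiffI empty_iff insert_iff)
  let ?x = "\<lambda>u. Poly_Mapping.single (\<xi> u) 1 :: 'n monom"
  have lcm: "lcm_monom {u, v} = v + ?x u" if uv: "u \<in> M" "v \<in> M" "u \<noteq> v" for u v
  proof -
    have only: "w = u \<or> w = v" if "w \<in> M" "lcm_monom {u, v} = w + k" for w k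
    proof (rule ccontr)
      assume "\<not> (w = u \<or> w = v)"
      then have "Poly_Mapping.lookup (lcm_monom {u, v}) (\<xi> w) < Poly_Mapping.lookup w (\<xi> w)"
        using \<xi>[OF that(1)] uv by (auto simp: lookup_lcm_pair)
      then show False using that(2) by (simp add: lookup_add)
    qed
    obtain k where k: "lcm_monom {u, v} = v + k"
      using monom_dvd_iff[of "lcm_monom {u, v}" v] by (auto simp: lookup_lcm_pair)
    have "mdeg (lcm_monom {u, v}) \<le> mdeg u + 1"
      using linear_resolution_mdeg_lcm_le[OF I(1) lin, of u v] uv only by (simp add: M_def)
    then have "mdeg k \<le> 1" using e uv by (simp add: k mdeg_add)
    \<comment> \<open>At \<open>\<xi> u\<close> the lcm has the exponent of u, which exceeds that of
      v; so this variable divides k, and k has degree at most 1.\<close>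
    have "Poly_Mapping.lookup (v + k) (\<xi> u) = Poly_Mapping.lookup u (\<xi> u)"
      using \<xi>[OF uv(1,2)] uv(3) by (simp add: lookup_lcm_pair flip: k)
    then have "Poly_Mapping.lookup k (\<xi> u) \<noteq> 0"
      using \<xi>[OF uv(1,2)] uv(3) by (auto simp: lookup_add)
    moreover from this have "mdeg k = 1"
      using \<open>mdeg k \<le> 1\<close> lookup_le_mdeg[of k "\<xi> u"] by linarith
    ultimately show ?thesis using k mdeg_eq_1D by metis
  qed
  obtain u\<^sub>0 where u\<^sub>0: "u\<^sub>0 \<in> M" using \<open>M \<noteq> {}\<close> by blast
  \<comment> \<open>The common factor is read off from one generator, as its quotient by its
    dominant variable.\<close>
  obtain t where t: "u\<^sub>0 = ?x u\<^sub>0 + t"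
    using monom_dvd_iff[of u\<^sub>0 "?x u\<^sub>0"] \<xi>0[OF u\<^sub>0] by (auto simp: lookup_single when_def)
  have form: "v = t + ?x v" if v: "v \<in> M" for v
  proof (cases "v = u\<^sub>0")
    case True
    then show ?thesis using t by (simp add: add.commute)
  next
    case False
    \<comment> \<open>Both sides are the lcm of v and \<open>u\<^sub>0\<close>, computed from either
      generator.\<close>
    then have "v + ?x u\<^sub>0 = u\<^sub>0 + ?x v"
      using lcm[OF u\<^sub>0 v] lcm[OF v u\<^sub>0] by (simp add: insert_commute)
    also have "\<dots> = (t + ?x v) + ?x u\<^sub>0" by (subst t) (simp add: ac_simps)
    finally show ?thesis by simp
  qed
  then have "M = (\<lambda>x. t + Poly_Mapping.single x 1) ` \<xi> ` M"
    by (force simp: image_image)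
  then have "I = (*) (mon t) ` ideal_gen (Var ` \<xi> ` M)"
    using gen unfolding mon_times_ideal_gen_Var by simp
  moreover have "\<xi> ` M \<noteq> {}" using \<open>M \<noteq> {}\<close> by simp
  ultimately show ?thesis by (intro exI conjI)
qed

theorem theorem3p1:
  fixes I :: "('n::finite, 'k::field) mpoly set" and us :: "'n monom list"
  assumes "monomial_ideal I" and "I \<noteq> {0}" and "I \<noteq> UNIV"
    and "linear_resolution I"
    and "distinct us" and "set us = min_gens I"
  shows "(taylor_minimal TYPE('k) us \<longleftrightarrow>
            (\<exists>A u. A \<noteq> {} \<and> I = (*) (mon u) ` ideal_gen (Var ` A))) \<and>
         (taylor_minimal TYPE('k) us \<longrightarrow> linear_quotients I)"
proof -
  have min: "taylor_minimal TYPE('k) us \<longleftrightarrow> (\<forall>u\<in>min_gens I. \<exists>x. \<forall>v\<in>min_gens I - {u}.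
      Poly_Mapping.lookup v x < Poly_Mapping.lookup u x)"
    using taylor_minimal_iff_dominant[OF assms(5)] assms(6) by simp
  have "taylor_minimal TYPE('k) us" if "I = (*) (mon u) ` ideal_gen (Var ` A)" for A u
    unfolding min that min_gens_mon_times_Var
  proof
    fix w assume "w \<in> (\<lambda>x. u + Poly_Mapping.single x 1) ` A"
    then obtain x where "w = u + Poly_Mapping.single x 1" by blast
    then show "\<exists>x. \<forall>v\<in>(\<lambda>x. u + Poly_Mapping.single x 1) ` A - {w}.
        Poly_Mapping.lookup v x < Poly_Mapping.lookup w x"
      \<comment> \<open>The variable x itself is dominant: the other generators have an exponent
        smaller by one there.\<close>
      by (intro exI[of _ x]) (auto simp: lookup_add lookup_single when_def split: if_splits)
  qed
  moreover have "linear_quotients I" if "I = (*) (mon u) ` ideal_gen (Var ` A)" for A u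
    unfolding that by (rule linear_quotients_mon_times_Var)
  moreover have "\<exists>A u. A \<noteq> {} \<and> I = (*) (mon u) ` ideal_gen (Var ` A)"
    if "taylor_minimal TYPE('k) us"
    using dominant_linear_resolution_form[OF assms(1-4)] that unfolding min by blast
  ultimately show ?thesis by blast
qed

end
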